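(* Let $D\subset\mathbb{R}^2$ be a non-degenerate closed triangle with vertices $v_1,v_2,v_3$, triangulated into subtriangles $D_1,\dots,D_N$, with the vertices of the triangulation properly coloured with the three colours $1,2,3$. Let a real value $z_u$ be given at every vertex $u$ of the triangulation, and let $h:D\to\mathbb{R}$ be the piecewise linear interpolant of these data. For each $n$ let $L_n:D\to D_n$ be the invertible affine map sending $v_k$ to the vertex of $D_n$ of colour $k$ ($k=1,2,3$), assume the $L_n$ are contractive, and let $\delta_n$ be the absolute value of the determinant of the linear part of $L_n$. Let $m\ge1$ be an integer and let $\alpha_{n7}=\alpha$ for all $n$, where $\alpha\in(-1,1)$ is fixed. Let $f:D\to\mathbb{R}$ be the bivariate Bernstein fractal interpolation function, i.e. the continuous function interpolating the data and satisfying $$f(x,y)=\alpha_{n7}f(L_n^{-1}(x,y))+h(x,y)-\alpha_{n7}B_m(h,L_n^{-1}(x,y)),\qquad (x,y)\in D_n,\ n=1,\dots,N.$$ Then the double integral $M_2=\iint_D f(x,y)\,dx\,dy$ is given by $$M_2=\frac{\displaystyle\sum_{n=1}^N\delta_n\iint_D h(L_n(u,v))\,du\,dv-\sum_{n=1}^N\delta_n\alpha_{n7}\iint_D B_m(h,u,v)\,du\,dv}{\displaystyle1-\sum_{n=1}^N\delta_n\alpha_{n7}}.$$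
   Context: A triangulation of $D$ is a decomposition into finitely many non-degenerate closed triangles such that any two of them are disjoint or meet exactly in a common vertex or a common full edge. Its vertices include $v_1,v_2,v_3$. A proper colouring assigns different colours to vertices joined by an edge, so the three vertices of each $D_n$ have three distinct colours. "The $L_n$ are contractive" means that there is a norm on $\mathbb{R}^2$ with respect to which every $L_n$ is Lipschitz with constant $<1$. The piecewise linear interpolant $h$ is the continuous function on $D$ that is affine on each $D_n$ with $h(u)=z_u$ at every vertex $u$. Bernstein polynomial on $D$: if $(\tau_1,\tau_2,\tau_3)$ are the barycentric coordinates of $(x,y)$ with respect to $D$, i.e. $(x,y)=\sum_j\tau_jv_j$ and $\sum_j\tau_j=1$, then $$B_m(h,x,y)=\sum_{i+j+k=m}\frac{m!}{i!\,j!\,k!}\,h\Bigl(\tfrac{i}{m}v_1+\tfrac{j}{m}v_2+\tfrac{k}{m}v_3\Bigr)\tau_1^i\tau_2^j\tau_3^k ,$$ the sum being over nonnegative integers $i,j,k$. *)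

theory Defs
  imports "HOL-Analysis.Analysis"
begin

text \<open>
  The index type \<^typ>\<open>3\<close>, whose elements are \<open>1\<close>, \<open>2\<close>, \<open>3\<close> (with \<open>3 = 0\<close>), serves both for the
  corners of \<open>D\<close> and for the colours. A triangle of a triangulation is given by its set of
  corners \<open>T n\<close>, for \<open>n \<in> {1..N}\<close>; the triangle itself is \<open>convex hull T n\<close>.
\<close>

definition triangle_corners :: "(real^2) set \<Rightarrow> bool" where
  "triangle_corners S \<longleftrightarrow> card S = 3 \<and> \<not> collinear S"

definition vertices :: "nat \<Rightarrow> (nat \<Rightarrow> (real^2) set) \<Rightarrow> (real^2) set" where
  "vertices N T = (\<Union>n\<in>{1..N}. T n)"

definition triangulation_of :: "(3 \<Rightarrow> real^2) \<Rightarrow> nat \<Rightarrow> (nat \<Rightarrow> (real^2) set) \<Rightarrow> bool" where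
  "triangulation_of v N T \<longleftrightarrow>
     (\<forall>n\<in>{1..N}. triangle_corners (T n)) \<and>
     (\<Union>n\<in>{1..N}. convex hull T n) = convex hull (range v) \<and>
     range v \<subseteq> vertices N T \<and>
     (\<forall>i\<in>{1..N}. \<forall>j\<in>{1..N}. i \<noteq> j \<longrightarrow>
        convex hull T i \<inter> convex hull T j = {} \<or>
        (\<exists>u \<in> T i \<inter> T j. convex hull T i \<inter> convex hull T j = {u}) \<or>
        (\<exists>u \<in> T i \<inter> T j. \<exists>w \<in> T i \<inter> T j. u \<noteq> w \<and>
           convex hull T i \<inter> convex hull T j = closed_segment u w))"

text \<open>Two vertices are joined by an edge iff they are distinct corners of a common triangle.\<close>

definition proper_colouring :: "nat \<Rightarrow> (nat \<Rightarrow> (real^2) set) \<Rightarrow> (real^2 \<Rightarrow> 3) \<Rightarrow> bool" where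
  "proper_colouring N T c \<longleftrightarrow>
     (\<forall>n\<in>{1..N}. \<forall>u\<in>T n. \<forall>w\<in>T n. u \<noteq> w \<longrightarrow> c u \<noteq> c w)"

definition affine_map_on :: "'a::real_vector set \<Rightarrow> ('a \<Rightarrow> 'b::real_vector) \<Rightarrow> bool" where
  "affine_map_on S f \<longleftrightarrow> (\<exists>A b. linear A \<and> (\<forall>x\<in>S. f x = A x + b))"

text \<open>The linear part is meaningful for maps that are affine on the whole space.\<close>

definition linear_part :: "('a::real_vector \<Rightarrow> 'b::real_vector) \<Rightarrow> 'a \<Rightarrow> 'b" where
  "linear_part f = (\<lambda>x. f x - f 0)"

definition pl_interpolant ::
  "(3 \<Rightarrow> real^2) \<Rightarrow> nat \<Rightarrow> (nat \<Rightarrow> (real^2) set) \<Rightarrow> (real^2 \<Rightarrow> real) \<Rightarrow> (real^2 \<Rightarrow> real) \<Rightarrow> bool" where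
  "pl_interpolant v N T z h \<longleftrightarrow>
     continuous_on (convex hull (range v)) h \<and>
     (\<forall>n\<in>{1..N}. affine_map_on (convex hull T n) h) \<and>
     (\<forall>u\<in>vertices N T. h u = z u)"

definition is_norm :: "('a::real_vector \<Rightarrow> real) \<Rightarrow> bool" where
  "is_norm \<nu> \<longleftrightarrow>
     (\<forall>x. 0 \<le> \<nu> x) \<and>
     (\<forall>x. \<nu> x = 0 \<longleftrightarrow> x = 0) \<and>
     (\<forall>a x. \<nu> (a *\<^sub>R x) = \<bar>a\<bar> * \<nu> x) \<and>
     (\<forall>x y. \<nu> (x + y) \<le> \<nu> x + \<nu> y)"

definition contractive_maps :: "'a::real_vector set \<Rightarrow> nat \<Rightarrow> (nat \<Rightarrow> 'a \<Rightarrow> 'a) \<Rightarrow> bool" where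
  "contractive_maps D N L \<longleftrightarrow>
     (\<exists>\<nu>. is_norm \<nu> \<and>
        (\<forall>n\<in>{1..N}. \<exists>s. 0 \<le> s \<and> s < 1 \<and>
           (\<forall>x\<in>D. \<forall>y\<in>D. \<nu> (L n x - L n y) \<le> s * \<nu> (x - y))))"

definition barycentric :: "(3 \<Rightarrow> real^2) \<Rightarrow> real^2 \<Rightarrow> real^3" where
  "barycentric v p =
     (THE \<tau>. p = (\<Sum>j\<in>UNIV. \<tau> $ j *\<^sub>R v j) \<and> (\<Sum>j\<in>UNIV. \<tau> $ j) = 1)"

definition bernstein :: "(3 \<Rightarrow> real^2) \<Rightarrow> nat \<Rightarrow> (real^2 \<Rightarrow> real) \<Rightarrow> real^2 \<Rightarrow> real" where
  "bernstein v m h p =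
     (let \<tau> = barycentric v p in
      \<Sum>(i, j, k) \<in> {(i, j, k). i + j + k = m}.
        fact m / (fact i * fact j * fact k) *
        h ((real i / real m) *\<^sub>R v 1 + (real j / real m) *\<^sub>R v 2 + (real k / real m) *\<^sub>R v 3) *
        (\<tau> $ 1) ^ i * (\<tau> $ 2) ^ j * (\<tau> $ 3) ^ k)"

end

(*
  Splitting the integral over the subtriangles (which overlap only in null sets) and changing
  variables along each L_n gives, for every g continuous on D, that the integral of g over D is
  the sum over n of delta_n times the integral of g o L_n over D. For g = f, the functional
  equation turns f o L_n into alpha f + h o L_n - alpha B_m(h), which is a linear equation for
  the integral of f. For g = 1 one gets sum_n delta_n = 1, so the coefficient 1 - alpha of the
  unknown does not vanish.
*)
theory Submission
  imports Defs
begin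

lemma absolutely_integrable_continuous_compact:
  fixes f :: "'a::euclidean_space \<Rightarrow> 'b::euclidean_space"
  assumes "compact S" and "continuous_on S f"
  shows "f absolutely_integrable_on S"
  using borel_integrable_compact[OF assms]
  by (simp add: set_integrable_def integrable_completion borel_measurable_integrable)

text \<open>The derivative of the map is \<open>A\<close> at every point, so the Jacobian factor is
  a constant and leaves the integral.\<close>

lemma integral_affine_image:
  fixes f :: "real^'n::{finite,wellorder} \<Rightarrow> real"
  assumes S: "S \<in> sets lebesgue"
    and A: "linear A"
    and inj: "inj_on (\<lambda>x. A x + b) S"
    and f: "f absolutely_integrable_on ((\<lambda>x. A x + b) ` S)"
  shows "integral ((\<lambda>x. A x + b) ` S) f = \<bar>det (matrix A)\<bar> * integral S (\<lambda>x. f (A x + b))"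
proof -
  let ?g = "\<lambda>x. A x + b"
  \<comment> \<open>The change of variables rule speaks of vector-valued integrands, so the real
    integrand passes through \<open>real^1\<close> and back.\<close>
  let ?F = "\<lambda>x. vec (f x) :: real^1"
  have der: "(?g has_derivative A) (at x within S)" for x
    using linear_imp_has_derivative[OF A] by (auto intro!: derivative_eq_intros)
  have F: "?F absolutely_integrable_on (?g ` S)"
    using f by (simp add: absolutely_integrable_on_1_iff)
  have lhs: "integral (?g ` S) ?F $ 1 = integral (?g ` S) f"
    using F by (simp add: integral_on_1_eq)
  have "integral (?g ` S) ?F = integral S (\<lambda>x. \<bar>det (matrix A)\<bar> *\<^sub>R ?F (?g x))"
    by (rule integral_change_of_variables[OF S der inj]) (use F in auto)
  also have "\<dots> = vec (integral S (\<lambda>x. \<bar>det (matrix A)\<bar> * f (?g x)))"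
    by (simp add: integral_on_1_eq vec_eq_iff)
  finally show ?thesis
    using lhs by simp
qed

lemma linear_part_affine:
  assumes "linear A"
  shows "linear_part (\<lambda>x. A x + b) = A"
  by (simp add: linear_part_def linear_0[OF assms])

text \<open>A segment is the hull of at most two points, too few to span interior in dimension 2 or
  more, and a convex set with empty interior is null.\<close>

lemma negligible_closed_segment:
  fixes a b :: "'a::euclidean_space"
  assumes "2 \<le> DIM('a)"
  shows "negligible (closed_segment a b)"
proof -
  have "interior (convex hull {a, b}) = {}"
    using assms by (intro empty_interior_convex_hull) (auto simp: card_insert_if)
  then show ?thesis
    by (simp add: segment_convex_hull negligible_convex_interior)
qed

text \<open>The empty set, a point and a segment are the only possible overlaps, and each is null in
  the plane.\<close>

lemma triangulation_of_negligible_Int: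
  assumes "triangulation_of v N T" and "i \<in> {1..N}" and "j \<in> {1..N}" and "i \<noteq> j"
  shows "negligible (convex hull T i \<inter> convex hull T j)"
proof -
  have "convex hull T i \<inter> convex hull T j = {} \<or>
      (\<exists>u. convex hull T i \<inter> convex hull T j = {u}) \<or>
      (\<exists>u w. convex hull T i \<inter> convex hull T j = closed_segment u w)"
    using assms unfolding triangulation_of_def by metis
  then show ?thesis
    using negligible_closed_segment[where 'a="real^2"] by auto
qed

text \<open>Non-collinear points have affine dimension 2, so the relative interior of their hull is
  a true interior. This later allows cancelling the area of \<open>D\<close>.\<close>

lemma measure_convex_hull_pos:
  fixes S :: "(real^2) set"
  assumes "finite S" and "\<not> collinear S"
  shows "measure lebesgue (convex hull S) > 0"
proof -
  have "aff_dim S \<le> 2"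
    using aff_dim_le_DIM[of S] by simp
  then have "aff_dim S = DIM(real^2)"
    using assms(2) by (simp add: collinear_aff_dim)
  then have "affine hull (convex hull S) = UNIV"
    using aff_dim_eq_full[of S] by simp
  \<comment> \<open>The empty set is collinear, so \<open>S\<close> is nonempty, and a nonempty
    convex set has nonempty relative interior.\<close>
  moreover have "rel_interior (convex hull S) \<noteq> {}"
    using assms(2) by (auto simp: rel_interior_eq_empty)
  ultimately have "\<not> negligible (convex hull S)"
    by (simp add: negligible_convex_interior rel_interior_interior)
  moreover have "convex hull S \<in> lmeasurable"
    using assms(1) by (simp add: finite_imp_compact_convex_hull lmeasurable_compact)
  ultimately show ?thesis
    by (simp add: negligible_iff_measure0 zero_less_measure_iff)
qed

lemma integral_triangulation_pullback:
  fixes g :: "real^2 \<Rightarrow> real"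
  assumes D: "D = convex hull (range v)"
    and triangulation: "triangulation_of v N T"
    and L_affine: "\<And>n. n \<in> {1..N} \<Longrightarrow> affine_map_on UNIV (L n)"
    and L_bij: "\<And>n. n \<in> {1..N} \<Longrightarrow> bij_betw (L n) D (convex hull T n)"
    and g: "continuous_on D g"
  shows "integral D g =
    (\<Sum>n=1..N. \<bar>det (matrix (linear_part (L n)))\<bar> * integral D (\<lambda>p. g (L n p)))"
proof -
  have "compact D"
    by (simp add: D finite_imp_compact_convex_hull)
  have union: "(\<Union>n\<in>{1..N}. convex hull T n) = D"
    using triangulation by (simp add: triangulation_of_def D)
  have "(g has_integral
      \<bar>det (matrix (linear_part (L n)))\<bar> * integral D (\<lambda>p. g (L n p))) (convex hull T n)"
    if n: "n \<in> {1..N}" for n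
  proof -
    obtain A b where A: "linear A" and L: "L n = (\<lambda>x. A x + b)"
      using L_affine[OF n] by (auto simp: affine_map_on_def)
    have img: "convex hull T n = (\<lambda>x. A x + b) ` D" and inj: "inj_on (\<lambda>x. A x + b) D"
      using L_bij[OF n] by (auto simp: bij_betw_def L)
    have "continuous_on D (\<lambda>x. A x + b)"
      by (intro continuous_intros linear_continuous_on linear_conv_bounded_linear[THEN iffD1] A)
    then have "compact (convex hull T n)"
      using \<open>compact D\<close> by (simp only: img compact_continuous_image)
    moreover have "continuous_on (convex hull T n) g"
      using g union n by (blast intro: continuous_on_subset)
    ultimately have abs: "g absolutely_integrable_on (convex hull T n)"
      by (rule absolutely_integrable_continuous_compact)
    have "integral (convex hull T n) g = \<bar>det (matrix A)\<bar> * integral D (\<lambda>x. g (A x + b))"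
      unfolding img
      by (rule integral_affine_image[OF _ A inj])
        (use abs \<open>compact D\<close> in \<open>simp_all add: img lmeasurable_compact fmeasurableD\<close>)
    moreover have "g integrable_on (convex hull T n)"
      using abs by (simp add: absolutely_integrable_on_def)
    ultimately show ?thesis
      by (simp add: L linear_part_affine[OF A] has_integral_iff)
  qed
  \<comment> \<open>Distinct subtriangles overlap in null sets, so the integrals over the pieces add
    up to the integral over their union.\<close>
  then have "(g has_integral
      (\<Sum>n=1..N. \<bar>det (matrix (linear_part (L n)))\<bar> * integral D (\<lambda>p. g (L n p))))
      (\<Union>n\<in>{1..N}. convex hull T n)"
    by (intro has_integral_UN)
      (auto simp: pairwise_def intro: triangulation_of_negligible_Int[OF triangulation])
  then show ?thesis
    unfolding union by (rule integral_unique)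
qed

theorem mainTheorem5:
  fixes v :: "3 \<Rightarrow> real^2"
    and D :: "(real^2) set"
    and N m :: nat
    and T :: "nat \<Rightarrow> (real^2) set"
    and c :: "real^2 \<Rightarrow> 3"
    and z h f :: "real^2 \<Rightarrow> real"
    and L :: "nat \<Rightarrow> real^2 \<Rightarrow> real^2"
    and \<delta> \<alpha>7 :: "nat \<Rightarrow> real"
    and \<alpha> :: real
  assumes nondegenerate: "\<not> collinear (range v)"
    and D: "D = convex hull (range v)"
    and triangulation: "triangulation_of v N T"
    and colouring: "proper_colouring N T c"
    and interpolant: "pl_interpolant v N T z h"
    and L_affine: "\<And>n. n \<in> {1..N} \<Longrightarrow> affine_map_on UNIV (L n)"
    and L_bij: "\<And>n. n \<in> {1..N} \<Longrightarrow> bij_betw (L n) D (convex hull T n)"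
    and L_corner: "\<And>n k. n \<in> {1..N} \<Longrightarrow> L n (v k) \<in> T n \<and> c (L n (v k)) = k"
    and L_contractive: "contractive_maps D N L"
    and \<delta>: "\<And>n. n \<in> {1..N} \<Longrightarrow> \<delta> n = \<bar>det (matrix (linear_part (L n)))\<bar>"
    and m: "m \<ge> 1"
    and \<alpha>: "-1 < \<alpha>" "\<alpha> < 1"
    and \<alpha>7: "\<And>n. n \<in> {1..N} \<Longrightarrow> \<alpha>7 n = \<alpha>"
    and f_continuous: "continuous_on D f"
    and f_interpolates: "\<And>u. u \<in> vertices N T \<Longrightarrow> f u = z u"
    and f_equation: "\<And>n p. n \<in> {1..N} \<Longrightarrow> p \<in> convex hull T n \<Longrightarrow>
      f p = \<alpha>7 n * f (inv_into D (L n) p) + h p - \<alpha>7 n * bernstein v m h (inv_into D (L n) p)"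
  shows "integral D f =
    ((\<Sum>n=1..N. \<delta> n * integral D (\<lambda>p. h (L n p)))
       - (\<Sum>n=1..N. \<delta> n * \<alpha>7 n * integral D (bernstein v m h)))
    / (1 - (\<Sum>n=1..N. \<delta> n * \<alpha>7 n))"
proof -
  have "compact D"
    by (simp add: D finite_imp_compact_convex_hull)
  have cont_integrable: "g integrable_on D" if "continuous_on D g" for g :: "real^2 \<Rightarrow> real"
    using absolutely_integrable_continuous_compact[OF \<open>compact D\<close> that]
    by (simp add: absolutely_integrable_on_def)
  have pullback: "integral D g = (\<Sum>n=1..N. \<delta> n * integral D (\<lambda>p. g (L n p)))"
    if "continuous_on D g" for g
    using integral_triangulation_pullback[OF D triangulation L_affine L_bij that] \<delta> by simp
  have comp: "continuous_on D (\<lambda>p. g (L n p))" if g: "continuous_on D g" and n: "n \<in> {1..N}"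
    for g :: "real^2 \<Rightarrow> real" and n
  proof (rule continuous_on_compose2[OF g])
    obtain A b where A: "linear A" and L: "L n = (\<lambda>x. A x + b)"
      using L_affine[OF n] by (auto simp: affine_map_on_def)
    show "continuous_on D (L n)"
      unfolding L
      by (intro continuous_intros linear_continuous_on linear_conv_bounded_linear[THEN iffD1] A)
    have "convex hull T n \<subseteq> D"
      using triangulation n by (auto simp: triangulation_of_def D)
    then show "L n ` D \<subseteq> D"
      using L_bij[OF n] by (simp add: bij_betw_def)
  qed
  have h: "continuous_on D h"
    using interpolant by (simp add: pl_interpolant_def D)
  \<comment> \<open>Reading the functional equation at \<open>p = L n q\<close> removes the inverse,
    since \<open>L n\<close> is injective on \<open>D\<close>.\<close>
  have f_L: "f (L n q) = \<alpha> * f q + h (L n q) - \<alpha> * bernstein v m h q"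
    if n: "n \<in> {1..N}" and q: "q \<in> D" for n q
  proof -
    have "L n q \<in> convex hull T n" and "inv_into D (L n) (L n q) = q"
      using L_bij[OF n] q by (auto simp: bij_betw_def)
    then show ?thesis
      using f_equation[OF n] \<alpha>7[OF n] by simp
  qed
  have piece: "integral D (\<lambda>p. f (L n p)) =
      \<alpha> * integral D f + integral D (\<lambda>p. h (L n p)) - \<alpha> * integral D (bernstein v m h)"
    if n: "n \<in> {1..N}" for n
  proof -
    \<comment> \<open>\<open>B\<^sub>m\<close> is integrable because the functional equation writes \<open>\<alpha> B\<^sub>m\<close> in terms of continuous functions.\<close>
    have B: "(\<lambda>q. \<alpha> * bernstein v m h q) integrable_on D"
    proof (rule integrable_eq)
      show "(\<lambda>q. \<alpha> * f q + h (L n q) - f (L n q)) integrable_on D"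
        by (intro cont_integrable continuous_intros f_continuous comp[OF f_continuous n]
            comp[OF h n])
    qed (simp add: f_L[OF n])
    have "integral D (\<lambda>p. f (L n p)) =
        integral D (\<lambda>q. (\<alpha> * f q + h (L n q)) - \<alpha> * bernstein v m h q)"
      by (rule integral_cong) (simp add: f_L[OF n])
    also have "\<dots> = integral D (\<lambda>q. \<alpha> * f q + h (L n q)) - integral D (\<lambda>q. \<alpha> * bernstein v m h q)"
      by (intro integral_diff B cont_integrable continuous_intros f_continuous comp[OF h n])
    also have "integral D (\<lambda>q. \<alpha> * f q + h (L n q)) =
        integral D (\<lambda>q. \<alpha> * f q) + integral D (\<lambda>q. h (L n q))"
      by (intro integral_add cont_integrable continuous_intros f_continuous comp[OF h n])
    \<comment> \<open>Only the multiple \<alpha> B_m is known to be integrable. Taking \<alpha> out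
      is still sound: for \<alpha> = 0 both sides vanish.\<close>
    finally show ?thesis
      by simp
  qed
  have "integral D (\<lambda>p. 1 :: real) = measure lebesgue D"
    using \<open>compact D\<close> by (simp add: lmeasure_integral lmeasurable_compact)
  then have "integral D (\<lambda>p. 1 :: real) > 0"
    using measure_convex_hull_pos[OF _ nondegenerate] by (simp add: D)
  moreover have "integral D (\<lambda>p. 1 :: real) = (\<Sum>n=1..N. \<delta> n) * integral D (\<lambda>p. 1 :: real)"
    using pullback[of "\<lambda>p. 1"] by (simp add: sum_distrib_right)
  \<comment> \<open>The positive area of \<open>D\<close> is cancelled.\<close>
  ultimately have sum_\<delta>: "(\<Sum>n=1..N. \<delta> n) = 1"
    by simp
  \<comment> \<open>The free factor \<open>x\<close> serves two ends: the integral of B_m in the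
    numerator and 1 in the denominator.\<close>
  have \<delta>\<alpha>: "(\<Sum>n=1..N. \<delta> n * \<alpha>7 n * x) = \<alpha> * x" for x
  proof -
    have "(\<Sum>n=1..N. \<delta> n * \<alpha>7 n * x) = (\<Sum>n=1..N. \<delta> n) * (\<alpha> * x)"
      unfolding sum_distrib_right by (rule sum.cong) (auto simp: \<alpha>7)
    then show ?thesis
      unfolding sum_\<delta> by simp
  qed
  have "integral D f = (\<Sum>n=1..N. \<delta> n * (\<alpha> * integral D f + integral D (\<lambda>p. h (L n p))
      - \<alpha> * integral D (bernstein v m h)))"
    using pullback[OF f_continuous] piece by simp
  \<comment> \<open>Terms that do not depend on \<open>n\<close> are collected, so that there the
    weights enter only through their sum, which is 1.\<close>
  also have "\<dots> = (\<Sum>n=1..N. \<delta> n * integral D (\<lambda>p. h (L n p)))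
      + (\<Sum>n=1..N. \<delta> n) * (\<alpha> * integral D f - \<alpha> * integral D (bernstein v m h))"
    unfolding sum_distrib_right sum.distrib[symmetric]
    by (rule sum.cong) (simp_all add: algebra_simps)
  finally have "integral D f * (1 - \<alpha>) = (\<Sum>n=1..N. \<delta> n * integral D (\<lambda>p. h (L n p)))
      - \<alpha> * integral D (bernstein v m h)"
    unfolding sum_\<delta> by (simp add: algebra_simps)
  \<comment> \<open>The denominator of the claim is 1 - \<alpha>, which is nonzero because \<alpha>
    < 1.\<close>
  then show ?thesis
    using \<open>\<alpha> < 1\<close> unfolding \<delta>\<alpha> \<delta>\<alpha>[of 1, unfolded mult_1_right]
    by (simp add: eq_divide_eq)
qed

end
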